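(* Let $K$ be a commutative ring, $R$ a $K$-algebra, $(X,\leqslant)$ a finite connected partially ordered set, and $A=I(X,R)$ its incidence algebra over $R$. Let $\mathrm{Mult}\,A$ be the group of multiplicative automorphisms of $A$ and $\mathrm{Mult}_0\,A$ its subgroup of fractional automorphisms. Fix a spanning tree $\mathcal T$ of the graph of $X$, and let $\mathrm{Mult}_1\,A$ be the subgroup of all $\psi\in\mathrm{Mult}\,A$ such that $\psi(e_{xy})=e_{xy}$ for all edges $(x,y)$ of $\mathcal T$ with $x<y$. Then the group $\mathrm{Mult}\,A$ is the (internal) direct product $$\mathrm{Mult}\,A=\mathrm{Mult}_1\,A\times\mathrm{Mult}_0\,A.$$
   Context: All rings are associative with a nonzero identity element. The graph of a finite partially ordered set $X$ is the simple graph with vertex set $X$ in which two distinct elements are joined by an edge iff they are comparable (all comparable pairs, not only covering pairs); $X$ is connected if this graph is connected. The incidence algebra is $I(X,R)=\{f\colon X\times X\to R \mid f(x,y)=0 \text{ if } x\not\leqslant y\}$ with pointwise addition and $K$-action and product $(fg)(x,y)=\sum_{x\leqslant z\leqslant y}f(x,z)g(z,y)$; it is a $K$-algebra. Put $A=I(X,R)$, $L=\{f\in A\mid f(x,y)=0 \text{ if } x\neq y\}$ (a subring) and $M=\{f\in A\mid f(x,x)=0 \text{ for all } x\in X\}$ (an ideal), so $A=L\oplus M$ as $K$-modules. For $x<y$ in $X$, $e_{xy}\in A$ is the function with $e_{xy}(x,y)=1$ and value $0$ on all other pairs. A $K$-algebra automorphism $\varphi$ of $A$ is multiplicative if $\varphi(a+c)=a+\beta(c)$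 for all $a\in L$, $c\in M$, for some map $\beta\colon M\to M$; these form the group $\mathrm{Mult}\,A$. An automorphism of $A$ is fractional if it has the form $a\mapsto v^{-1}av$ with $v$ an invertible central element of the ring $L$; these form the subgroup $\mathrm{Mult}_0\,A\subseteq\mathrm{Mult}\,A$. *)

theory Defs
  imports Complex_Main "HOL-Algebra.Coset"
begin

section \<open>Algebras over a commutative ring\<close>

text \<open>The class \<open>ring_1\<close> includes \<open>0 \<noteq> 1\<close>, so rings are associative with a nonzero identity.\<close>

locale k_algebra = module scale
  for scale :: "'k::comm_ring_1 \<Rightarrow> 'r::ring_1 \<Rightarrow> 'r" +
  assumes scale_mult_left: "scale k a * b = scale k (a * b)"
    and scale_mult_right: "a * scale k b = scale k (a * b)"

definition algebra_automorphism ::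
  "('k::comm_ring_1 \<Rightarrow> 'a::ring_1 \<Rightarrow> 'a) \<Rightarrow> ('a \<Rightarrow> 'a) \<Rightarrow> bool" where
  "algebra_automorphism scale \<phi> \<longleftrightarrow>
     module_hom scale scale \<phi> \<and> \<phi> 1 = 1 \<and> (\<forall>a b. \<phi> (a * b) = \<phi> a * \<phi> b) \<and> bij \<phi>"


section \<open>The incidence algebra of a finite partially ordered set\<close>

typedef (overloaded) ('x::"{finite,order}", 'r::ring_1) incidence =
  "{f :: 'x \<Rightarrow> 'x \<Rightarrow> 'r. \<forall>x y. \<not> x \<le> y \<longrightarrow> f x y = 0}"
  morphisms entry Abs_incidence
  by (rule exI[of _ "\<lambda>_ _. 0"]) simp

setup_lifting type_definition_incidence

lemma entry_eq_0: "\<not> x \<le> y \<Longrightarrow> entry f x y = 0"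
  by transfer simp

instantiation incidence :: ("{finite,order}", ring_1) ring_1
begin

lift_definition zero_incidence :: "('a, 'b) incidence" is "\<lambda>x y. 0"
  by simp

lift_definition one_incidence :: "('a, 'b) incidence" is "\<lambda>x y. if x = y then 1 else 0"
  by auto

lift_definition plus_incidence :: "('a, 'b) incidence \<Rightarrow> ('a, 'b) incidence \<Rightarrow> ('a, 'b) incidence"
  is "\<lambda>f g x y. f x y + g x y"
  by simp

lift_definition uminus_incidence :: "('a, 'b) incidence \<Rightarrow> ('a, 'b) incidence"
  is "\<lambda>f x y. - f x y"
  by simp

lift_definition minus_incidence :: "('a, 'b) incidence \<Rightarrow> ('a, 'b) incidence \<Rightarrow> ('a, 'b) incidence"
  is "\<lambda>f g x y. f x y - g x y"
  by simp

lift_definition times_incidence :: "('a, 'b) incidence \<Rightarrow> ('a, 'b) incidence \<Rightarrow> ('a, 'b) incidence"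
  is "\<lambda>f g x y. \<Sum>z | x \<le> z \<and> z \<le> y. f x z * g z y"
  by (auto intro!: sum.neutral dest: order_trans)

lemma entry_times_UNIV: "entry (f * g) x y = (\<Sum>z\<in>UNIV. entry f x z * entry g z y)"
  unfolding times_incidence.rep_eq
proof (rule sum.mono_neutral_left)
  show "\<forall>z\<in>UNIV - {z. x \<le> z \<and> z \<le> y}. entry f x z * entry g z y = 0"
    using entry_eq_0[of x _ f] entry_eq_0[of _ y g] by (metis (mono_tags, lifting) DiffE mem_Collect_eq mult_zero_left mult_zero_right)
qed simp_all

instance
proof
  fix a b c :: "('a, 'b) incidence"
  have "entry (a * b * c) x y = entry (a * (b * c)) x y" for x y
    unfolding entry_times_UNIV sum_distrib_left sum_distrib_right
    by (subst sum.swap) (simp add: mult.assoc)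
  then show "a * b * c = a * (b * c)"
    by (simp add: entry_inject[symmetric] fun_eq_iff)
  show "1 * a = a" "a * 1 = a"
    by (simp_all add: entry_inject[symmetric] fun_eq_iff entry_times_UNIV one_incidence.rep_eq
        if_distrib[of "\<lambda>u. u * _"] if_distrib[of "(*) _"] cong: if_cong)
  show "(a + b) * c = a * c + b * c" "a * (b + c) = a * b + a * c"
    by (simp_all add: entry_inject[symmetric] fun_eq_iff entry_times_UNIV plus_incidence.rep_eq
        distrib_left distrib_right sum.distrib)
  show "a + b + c = a + (b + c)" "a + b = b + a" "0 + a = a" "- a + a = 0" "a - b = a + - b"
    by (transfer; simp add: fun_eq_iff algebra_simps)+
  show "(0 :: ('a, 'b) incidence) \<noteq> 1"
    by transfer (simp add: fun_eq_iff)
qed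

end

text \<open>The value is truncated outside the order relation only to make the operation total: when
  \<open>scale\<close> is the action of an algebra, \<open>scale k 0 = 0\<close> and the action is pointwise.\<close>

lift_definition incidence_scale ::
  "('k::comm_ring_1 \<Rightarrow> 'r::ring_1 \<Rightarrow> 'r) \<Rightarrow> 'k \<Rightarrow> ('x::{finite,order}, 'r) incidence \<Rightarrow> ('x, 'r) incidence"
  is "\<lambda>scale k f x y. if x \<le> y then scale k (f x y) else 0"
  by simp

lemma (in k_algebra) entry_incidence_scale:
  "entry (incidence_scale scale k f) x y = scale k (entry f x y)"
  by (simp add: incidence_scale.rep_eq entry_eq_0)

lemma (in k_algebra) k_algebra_incidence:
  "k_algebra (incidence_scale scale :: 'k \<Rightarrow> ('x::{finite,order}, 'r) incidence \<Rightarrow> ('x, 'r) incidence)"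
  by unfold_locales
    (simp_all add: entry_inject[symmetric] fun_eq_iff entry_incidence_scale entry_times_UNIV
      plus_incidence.rep_eq scale_right_distrib scale_left_distrib scale_mult_left scale_mult_right
      scale_sum_right)

definition diagonal_part :: "('x::{finite,order}, 'r::ring_1) incidence set" where
  "diagonal_part = {f. \<forall>x y. x \<noteq> y \<longrightarrow> entry f x y = 0}"

definition strict_part :: "('x::{finite,order}, 'r::ring_1) incidence set" where
  "strict_part = {f. \<forall>x. entry f x x = 0}"

text \<open>The element \<open>e\<^sub>x\<^sub>y\<close>; it is only used for \<open>x < y\<close>, and is \<open>0\<close> if \<open>x \<le> y\<close> fails.\<close>

lift_definition incidence_unit ::
  "'x::{finite,order} \<Rightarrow> 'x \<Rightarrow> ('x, 'r::ring_1) incidence"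
  is "\<lambda>x y u v. if u = x \<and> v = y \<and> x \<le> y then 1 else 0"
  by auto


section \<open>Multiplicative and fractional automorphisms\<close>

text \<open>In this section \<open>scale\<close> is the action of \<open>K\<close> on the coefficient ring \<open>R\<close>.\<close>

definition Mult ::
  "('k::comm_ring_1 \<Rightarrow> 'r::ring_1 \<Rightarrow> 'r) \<Rightarrow>
   (('x::{finite,order}, 'r) incidence \<Rightarrow> ('x, 'r) incidence) set" where
  "Mult scale =
    {\<phi>. algebra_automorphism (incidence_scale scale) \<phi> \<and>
        (\<exists>\<beta> \<in> strict_part \<rightarrow> strict_part.
           \<forall>a \<in> diagonal_part. \<forall>c \<in> strict_part. \<phi> (a + c) = a + \<beta> c)}"

definition Mult_group ::
  "('k::comm_ring_1 \<Rightarrow> 'r::ring_1 \<Rightarrow> 'r) \<Rightarrow>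
   (('x::{finite,order}, 'r) incidence \<Rightarrow> ('x, 'r) incidence) monoid" where
  "Mult_group scale = \<lparr>carrier = Mult scale, mult = (\<circ>), one = id\<rparr>"

definition Mult0 ::
  "('k::comm_ring_1 \<Rightarrow> 'r::ring_1 \<Rightarrow> 'r) \<Rightarrow>
   (('x::{finite,order}, 'r) incidence \<Rightarrow> ('x, 'r) incidence) set" where
  "Mult0 scale =
    {\<phi>. algebra_automorphism (incidence_scale scale) \<phi> \<and>
        (\<exists>v \<in> diagonal_part. \<exists>w \<in> diagonal_part.
           (\<forall>u \<in> diagonal_part. v * u = u * v) \<and> v * w = 1 \<and> w * v = 1 \<and>
           \<phi> = (\<lambda>a. w * a * v))}"

definition Mult1 ::
  "('k::comm_ring_1 \<Rightarrow> 'r::ring_1 \<Rightarrow> 'r) \<Rightarrow> 'x::{finite,order} set set \<Rightarrow>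
   (('x, 'r) incidence \<Rightarrow> ('x, 'r) incidence) set" where
  "Mult1 scale T =
    {\<psi> \<in> Mult scale.
       \<forall>x y. {x, y} \<in> T \<and> x < y \<longrightarrow> \<psi> (incidence_unit x y) = incidence_unit x y}"


section \<open>Graphs and spanning trees\<close>

text \<open>A simple graph whose vertices are all elements of the type \<open>'x\<close> is represented by its set of
  edges, each edge being a two-element set. (The notion of tree in the AFP entry on digraphs
  excludes directed cycles only, and hence is not the one needed here.)\<close>

definition comparability_graph :: "'x::order set set" where
  "comparability_graph = {{x, y} | x y. x \<noteq> y \<and> (x \<le> y \<or> y \<le> x)}"

definition graph_connected :: "'x set set \<Rightarrow> bool" where
  "graph_connected E \<longleftrightarrow> (\<forall>u v. (u, v) \<in> {(x, y). {x, y} \<in> E}\<^sup>*)"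

definition graph_cycle :: "'x set set \<Rightarrow> 'x list \<Rightarrow> bool" where
  "graph_cycle E p \<longleftrightarrow>
     3 \<le> length p \<and> distinct p \<and>
     (\<forall>i < length p. {p ! i, p ! (Suc i mod length p)} \<in> E)"

definition spanning_tree :: "'x set set \<Rightarrow> 'x set set \<Rightarrow> bool" where
  "spanning_tree T E \<longleftrightarrow> T \<subseteq> E \<and> graph_connected T \<and> (\<nexists>p. graph_cycle T p)"


section \<open>Internal direct products of groups\<close>

definition internal_direct_product :: "('g, 'm) monoid_scheme \<Rightarrow> 'g set \<Rightarrow> 'g set \<Rightarrow> bool" where
  "internal_direct_product G H N \<longleftrightarrow>
     H \<lhd> G \<and> N \<lhd> G \<and> H <#>\<^bsub>G\<^esub> N = carrier G \<and> H \<inter> N = {\<one>\<^bsub>G\<^esub>}"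

end

theory Submission
  imports Defs
begin

text \<open>A multiplicative automorphism \<open>\<phi>\<close> fixes the diagonal elements, so it is a map of bimodules over
  them. Compressing by the diagonal idempotents at \<open>x\<close> and \<open>y\<close> isolates the entry at \<open>(x, y)\<close>;
  hence \<open>\<phi>\<close> only multiplies that entry by some \<open>c x y\<close>. Linearity over diagonal elements from both
  sides makes \<open>c x y\<close> central in \<open>R\<close>, surjectivity makes it a unit, and multiplicativity says
  \<open>c x z = c x y * c y z\<close> for \<open>x \<le> y \<le> z\<close>. Conversely, each such \<^emph>\<open>cocycle\<close> defines a multiplicative
  automorphism (\<open>Mult_eq_twist_cocycles\<close>). Composition corresponds to pointwise multiplication of
  cocycles, so the group of multiplicative automorphisms is commutative and normality of subgroups is
  automatic.

  A central element of the diagonal subring has central elements of \<open>R\<close> on its diagonal, and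
  conjugation by an invertible one multiplies the entry at \<open>(x, y)\<close> by \<open>inverse (v x) * v y\<close>. So the
  fractional automorphisms are the twists by \<^emph>\<open>coboundaries\<close>
  (\<open>Mult0_eq_twist_coboundaries\<close>), while the other factor consists of the twists by cocycles
  equal to \<open>1\<close> on the edges of the tree (\<open>Mult1_eq_twist\<close>).

  What remains is a statement on graphs. Since the tree has no cycles, every labelling of its
  oriented edges by elements of a commutative group comes from a vertex potential (\<open>potential_exists\<close>).
  Therefore each cocycle agrees with some coboundary on the tree, and dividing by it leaves a cocycle
  trivial on the tree: the two subgroups generate the whole group. Since the tree is connected, a
  coboundary trivial on its edges comes from a constant potential and is trivial
  (\<open>coboundary_trivial_on_connected\<close>): the two subgroups intersect trivially.\<close>


section \<open>Central units and multiplicative cocycles\<close>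

text \<open>Packaging the central units as a group with an explicit carrier makes inverses available and
  lets the result on potentials be stated for an arbitrary commutative group.\<close>

definition central_units :: "'r::ring_1 monoid" where
  "central_units = units_of \<lparr>carrier = {z. \<forall>r. z * r = r * z}, mult = (*), one = 1\<rparr>"

lemma comm_group_central_units: "comm_group (central_units :: 'r::ring_1 monoid)"
proof -
  let ?Z = "{z :: 'r. \<forall>r. z * r = r * z}"
  have closed: "x * y \<in> ?Z" if "x \<in> ?Z" "y \<in> ?Z" for x y
  proof (rule CollectI, rule allI)
    fix r
    have "x * r = r * x" "y * r = r * y" using that by blast+
    then show "x * y * r = r * (x * y)" by (metis mult.assoc)
  qed
  have "comm_monoid \<lparr>carrier = ?Z, mult = (*), one = 1\<rparr>"
  proof (rule comm_monoidI, unfold partial_object.simps monoid.simps)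
    show "x * y \<in> ?Z" if "x \<in> ?Z" "y \<in> ?Z" for x y using that by (rule closed)
    show "x * y = y * x" if "x \<in> ?Z" for x y using that by blast
    show "1 \<in> ?Z" by (rule CollectI) simp
    show "x * y * z = x * (y * z)" for x y z :: 'r by (rule mult.assoc)
    show "1 * x = x" for x :: 'r by (rule mult_1_left)
  qed
  then show ?thesis unfolding central_units_def by (rule comm_monoid.units_comm_group)
qed

interpretation central_units: comm_group "central_units :: 'r::ring_1 monoid"
  by (rule comm_group_central_units)

lemma mult_central_units [simp]: "x \<otimes>\<^bsub>central_units\<^esub> y = x * y"
  and one_central_units [simp]: "\<one>\<^bsub>central_units\<^esub> = 1"
  by (simp_all add: central_units_def units_of_def)

lemma central_units_commute: "z \<in> carrier central_units \<Longrightarrow> z * r = r * z"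
  unfolding central_units_def units_of_def Units_def partial_object.simps by blast

text \<open>A right inverse suffices: centrality turns it into a two-sided inverse, and the inverse of a
  central element is central as well.\<close>

lemma central_unitsI:
  assumes central: "\<And>r. z * r = r * z" and inverse: "z * w = 1"
  shows "z \<in> carrier central_units"
proof -
  have "w * z = 1" using central[of w] inverse by simp
  have "w * r = r * w" for r
  proof -
    have "w * r = w * r * (z * w)" by (simp add: inverse)
    also have "\<dots> = w * (z * r) * w" unfolding central[of r] by (simp add: mult.assoc)
    also have "\<dots> = (w * z) * r * w" by (simp add: mult.assoc)
    finally show ?thesis by (simp add: \<open>w * z = 1\<close>)
  qed
  with assms \<open>w * z = 1\<close> show ?thesis
    unfolding central_units_def units_of_def Units_def partial_object.simps monoid.simps by blast
qed

lemma central_units_inv_mult [simp]: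
  "z \<in> carrier central_units \<Longrightarrow> inv\<^bsub>central_units\<^esub> z * z = 1"
  "z \<in> carrier central_units \<Longrightarrow> z * inv\<^bsub>central_units\<^esub> z = 1"
  using central_units.l_inv[of z] central_units.r_inv[of z] by simp_all

lemma central_units_inv_one [simp]: "inv\<^bsub>central_units\<^esub> 1 = 1"
  by (metis central_units.inv_one one_central_units)

lemma one_in_central_units [simp]: "1 \<in> carrier central_units"
  using central_units.one_closed by simp

lemma mult_in_central_units [simp]:
  "z \<in> carrier central_units \<Longrightarrow> w \<in> carrier central_units \<Longrightarrow> z * w \<in> carrier central_units"
  using central_units.m_closed[of z w] by simp

text \<open>The functions are total; their values outside the order relation are arbitrary central units,
  because twisting only meets entries with \<open>x \<le> y\<close>.\<close>

definition cocycles :: "('x::order \<Rightarrow> 'x \<Rightarrow> 'r::ring_1) set" where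
  "cocycles = {c. (\<forall>x y. c x y \<in> carrier central_units) \<and>
                  (\<forall>x y z. x \<le> y \<and> y \<le> z \<longrightarrow> c x z = c x y * c y z)}"

definition coboundaries :: "('x \<Rightarrow> 'x \<Rightarrow> 'r::ring_1) set" where
  "coboundaries = {\<lambda>x y. inv\<^bsub>central_units\<^esub> v x * v y | v. \<forall>x. v x \<in> carrier central_units}"

lemma cocycle_closed: "c \<in> cocycles \<Longrightarrow> c x y \<in> carrier central_units"
  by (simp add: cocycles_def)

lemma cocycle_mult: "c \<in> cocycles \<Longrightarrow> x \<le> y \<Longrightarrow> y \<le> z \<Longrightarrow> c x z = c x y * c y z"
  unfolding cocycles_def by blast

lemma cocycle_refl:
  assumes c: "c \<in> cocycles"
  shows "c x x = 1"
proof -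
  have "c x x * c x x = c x x" by (rule cocycle_mult[OF c, symmetric]) simp_all
  then show ?thesis
    using central_units.r_cancel_one[of "c x x" "c x x"] cocycle_closed[OF c, of x x] by simp
qed

lemma cocycles_one: "(\<lambda>x y. 1) \<in> cocycles"
  by (simp add: cocycles_def)

lemma cocyclesI:
  assumes "\<And>x y. c x y \<in> carrier central_units"
    and "\<And>x y z. x \<le> y \<Longrightarrow> y \<le> z \<Longrightarrow> c x z = c x y * c y z"
  shows "c \<in> cocycles"
  using assms unfolding cocycles_def by blast

lemma cocycles_times:
  assumes c: "c \<in> cocycles" and d: "d \<in> cocycles"
  shows "(\<lambda>x y. c x y * d x y) \<in> cocycles"
proof (rule cocyclesI)
  fix x y z :: 'a assume le: "x \<le> y" "y \<le> z"
  have "c y z * d x y = d x y * c y z" by (rule central_units_commute[OF cocycle_closed[OF c]])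
  then show "c x z * d x z = c x y * d x y * (c y z * d y z)"
    unfolding cocycle_mult[OF c le] cocycle_mult[OF d le] by (metis mult.assoc)
qed (simp add: c d cocycle_closed)

lemma cocycles_inverse:
  assumes c: "c \<in> cocycles"
  shows "(\<lambda>x y. inv\<^bsub>central_units\<^esub> c x y) \<in> cocycles"
proof (rule cocyclesI)
  fix x y z :: 'a assume le: "x \<le> y" "y \<le> z"
  show "inv\<^bsub>central_units\<^esub> c x z = inv\<^bsub>central_units\<^esub> c x y * inv\<^bsub>central_units\<^esub> c y z"
    unfolding cocycle_mult[OF c le] using central_units.inv_mult[of "c x y" "c y z"] c
    by (simp add: cocycle_closed)
qed (simp add: cocycle_closed[OF c])

lemma coboundaries_subset_cocycles: "coboundaries \<subseteq> cocycles"
proof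
  fix c :: "'a \<Rightarrow> 'a \<Rightarrow> 'b"
  assume "c \<in> coboundaries"
  then obtain v where v: "\<And>x. v x \<in> carrier central_units"
    and c: "c = (\<lambda>x y. inv\<^bsub>central_units\<^esub> v x * v y)"
    by (auto simp: coboundaries_def)
  show "c \<in> cocycles" unfolding c
  proof (rule cocyclesI)
    fix x y z
    have "v y * (inv\<^bsub>central_units\<^esub> v y * v z) = v z"
      using v by (simp flip: mult.assoc)
    then show "inv\<^bsub>central_units\<^esub> v x * v z
        = inv\<^bsub>central_units\<^esub> v x * v y * (inv\<^bsub>central_units\<^esub> v y * v z)"
      by (simp add: mult.assoc)
  qed (use v in simp)
qed

lemma coboundaries_one: "(\<lambda>x y. 1) \<in> coboundaries"
  unfolding coboundaries_def
  by (rule CollectI, rule exI[of _ "\<lambda>_. 1"]) simp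

lemma coboundaries_times:
  assumes "c \<in> coboundaries" "d \<in> coboundaries"
  shows "(\<lambda>x y. c x y * d x y) \<in> coboundaries"
proof -
  obtain v w where v: "\<And>x. v x \<in> carrier central_units"
    and c: "c = (\<lambda>x y. inv\<^bsub>central_units\<^esub> v x * v y)"
    and w: "\<And>x. w x \<in> carrier central_units"
    and d: "d = (\<lambda>x y. inv\<^bsub>central_units\<^esub> w x * w y)"
    using assms by (auto simp: coboundaries_def)
  have "c x y * d x y = inv\<^bsub>central_units\<^esub> (v x * w x) * (v y * w y)" for x y
    using v w central_units.inv_mult[of "v x" "w x"]
      central_units_commute[of "inv\<^bsub>central_units\<^esub> w x" "v y"]
    unfolding c d by (simp add: mult.assoc) (metis mult.assoc)
  with v w show ?thesis unfolding coboundaries_def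
    by (intro CollectI exI[of _ "\<lambda>x. v x * w x"]) simp
qed

lemma coboundaries_inverse:
  assumes "c \<in> coboundaries"
  shows "(\<lambda>x y. inv\<^bsub>central_units\<^esub> c x y) \<in> coboundaries"
proof -
  obtain v where v: "\<And>x. v x \<in> carrier central_units"
    and c: "c = (\<lambda>x y. inv\<^bsub>central_units\<^esub> v x * v y)"
    using assms by (auto simp: coboundaries_def)
  have "inv\<^bsub>central_units\<^esub> c x y
      = inv\<^bsub>central_units\<^esub> (inv\<^bsub>central_units\<^esub> v x) * inv\<^bsub>central_units\<^esub> v y" for x y
    using v central_units.inv_mult[of "inv\<^bsub>central_units\<^esub> v x" "v y"] unfolding c by simp
  with v show ?thesis unfolding coboundaries_def
    by (intro CollectI exI[of _ "\<lambda>x. inv\<^bsub>central_units\<^esub> v x"]) simp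
qed


section \<open>Potentials on acyclic graphs\<close>

lemma graph_cycle_mono: "graph_cycle T p \<Longrightarrow> T \<subseteq> E \<Longrightarrow> graph_cycle E p"
  by (auto simp: graph_cycle_def)

text \<open>Loops are cut while the path grows from its end: if the new first vertex already occurs, the
  path is shortened to the part that starts there.\<close>

lemma rtrancl_imp_distinct_path:
  assumes "(a, b) \<in> {(x, y). {x, y} \<in> T}\<^sup>*"
  shows "\<exists>p. p \<noteq> [] \<and> distinct p \<and> hd p = a \<and> last p = b \<and>
    (\<forall>i. Suc i < length p \<longrightarrow> {p ! i, p ! Suc i} \<in> T)"
  using assms
proof (induction rule: converse_rtrancl_induct)
  case base
  show ?case by (rule exI[of _ "[b]"]) simp
next
  case (step a c)
  then obtain p where p: "p \<noteq> []" "distinct p" "hd p = c" "last p = b"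
    "\<And>i. Suc i < length p \<Longrightarrow> {p ! i, p ! Suc i} \<in> T" by blast
  show ?case
  proof (cases "a \<in> set p")
    case True
    then obtain ys zs where ys: "p = ys @ a # zs" by (meson split_list)
    have "{(a # zs) ! i, (a # zs) ! Suc i} \<in> T" if "Suc i < length (a # zs)" for i
      using p(5)[of "length ys + i"] that by (simp add: ys nth_append)
    with p ys show ?thesis by (intro exI[of _ "a # zs"]) auto
  next
    case False
    have "{(a # p) ! i, (a # p) ! Suc i} \<in> T" if "Suc i < length (a # p)" for i
      using p that step(1) by (cases i) (auto simp: hd_conv_nth)
    with p False show ?thesis by (intro exI[of _ "a # p"]) auto
  qed
qed

text \<open>A simple path from \<open>a\<close> to \<open>b\<close> is closed to a cycle by the new edge. It has at least the three
  vertices that a cycle needs, as a path with two vertices would be the edge itself.\<close>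

lemma closing_edge_imp_graph_cycle:
  assumes conn: "(a, b) \<in> {(x, y). {x, y} \<in> T}\<^sup>*" and "a \<noteq> b" "{a, b} \<notin> T"
  shows "\<exists>p. graph_cycle (insert {a, b} T) p"
proof -
  obtain p where p: "p \<noteq> []" "distinct p" "hd p = a" "last p = b"
    "\<And>i. Suc i < length p \<Longrightarrow> {p ! i, p ! Suc i} \<in> T"
    using rtrancl_imp_distinct_path[OF conn] by blast
  have "length p \<noteq> 1" using p \<open>a \<noteq> b\<close> by (auto simp: length_Suc_conv)
  moreover have "length p \<noteq> 2"
  proof
    assume "length p = 2"
    with p have "p ! 0 = a" "p ! 1 = b" by (simp_all add: hd_conv_nth last_conv_nth)
    with p(5)[of 0] \<open>length p = 2\<close> \<open>{a, b} \<notin> T\<close> show False by simp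
  qed
  moreover have "length p \<noteq> 0" using p by simp
  ultimately have "3 \<le> length p" by linarith
  moreover have "{p ! i, p ! (Suc i mod length p)} \<in> insert {a, b} T" if "i < length p" for i
  proof (cases "Suc i = length p")
    case True
    then have "p ! i = b" "p ! 0 = a"
      using p by (auto simp: hd_conv_nth last_conv_nth dest: arg_cong[of _ _ "\<lambda>n. n - 1"])
    with True show ?thesis by (simp add: insert_commute)
  next
    case False
    with that p(5)[of i] show ?thesis by simp
  qed
  ultimately show ?thesis using p(2) unfolding graph_cycle_def by blast
qed

text \<open>Edges are added one at a time. A new edge joins two different components, since otherwise it would
  close a cycle; multiplying the potential by a constant on one of the two components leaves the
  condition on the old edges intact and can be used to satisfy the condition on the new edge.\<close>

lemma (in comm_group) potential_exists:
  assumes "finite T" "\<nexists>p. graph_cycle T p"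
    and "\<And>e. e \<in> T \<Longrightarrow> \<exists>x y. x \<noteq> y \<and> e = {x, y}"
    and g_closed: "\<And>x y. g x y \<in> carrier G" and g_inv: "\<And>x y. x \<noteq> y \<Longrightarrow> g y x = inv g x y"
  shows "\<exists>v. (\<forall>x. v x \<in> carrier G) \<and> (\<forall>x y. {x, y} \<in> T \<longrightarrow> v y = v x \<otimes> g x y)"
  using assms(1-3)
proof (induction T rule: finite_induct)
  case empty
  show ?case by (rule exI[of _ "\<lambda>_. \<one>"]) simp
next
  case (insert e T)
  obtain a b where e: "e = {a, b}" "a \<noteq> b" using insert.prems(2) by blast
  have "\<nexists>p. graph_cycle T p" using insert.prems(1) graph_cycle_mono by blast
  moreover have "\<exists>x y. x \<noteq> y \<and> e = {x, y}" if "e \<in> T" for e using insert.prems(2) that by blast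
  ultimately obtain v where v: "\<And>x. v x \<in> carrier G"
    "\<And>x y. {x, y} \<in> T \<Longrightarrow> v y = v x \<otimes> g x y"
    using insert.IH by blast
  \<comment> \<open>The connected component of \<open>b\<close> before the new edge is added.\<close>
  define B where "B = {x. (x, b) \<in> {(x, y). {x, y} \<in> T}\<^sup>*}"
  have "a \<notin> B"
    using closing_edge_imp_graph_cycle[of a b T] insert.prems(1) insert.hyps(2) e B_def by blast
  have "b \<in> B" by (simp add: B_def)
  have B_step: "x \<in> B" if "{x, y} \<in> T" "y \<in> B" for x y
    using that unfolding B_def by (auto intro: converse_rtrancl_into_rtrancl)
  have B_edge: "x \<in> B \<longleftrightarrow> y \<in> B" if "{x, y} \<in> T" for x y
    using B_step[of x y] B_step[of y x] that by (auto simp: insert_commute)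
  \<comment> \<open>The constant for which the new value \<open>t \<otimes> v b\<close> at \<open>b\<close> is the value \<open>v a \<otimes> g a b\<close> that the new edge
    demands.\<close>
  define t where "t = v a \<otimes> g a b \<otimes> inv v b"
  have t: "t \<in> carrier G" by (simp add: t_def v g_closed)
  define w where "w = (\<lambda>x. if x \<in> B then t \<otimes> v x else v x)"
  have w: "w x \<in> carrier G" for x by (simp add: w_def v t)
  have wab: "w b = w a \<otimes> g a b"
    using \<open>a \<notin> B\<close> \<open>b \<in> B\<close> by (simp add: w_def t_def v g_closed m_assoc)
  have "w y = w x \<otimes> g x y" if "{x, y} \<in> insert e T" for x y
  proof (cases "{x, y} \<in> T")
    case True
    with v(2)[OF True] B_edge[OF True] show ?thesis by (simp add: w_def v t g_closed m_assoc)
  next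
    case False
    with that e consider "x = a" "y = b" | "x = b" "y = a" by (auto simp: doubleton_eq_iff)
    then show ?thesis
    proof cases
      case 2
      then show ?thesis using wab g_inv[OF e(2)] by (simp add: m_assoc w g_closed)
    qed (use wab in simp)
  qed
  with w show ?case by blast
qed


section \<open>Multiplicative automorphisms are twists by cocycles\<close>

lift_definition twist ::
  "('x \<Rightarrow> 'x \<Rightarrow> 'r) \<Rightarrow> ('x::{finite,order}, 'r::ring_1) incidence \<Rightarrow> ('x, 'r) incidence"
  is "\<lambda>c f x y. c x y * f x y"
  by simp

lemma incidence_eqI: "(\<And>x y. x \<le> y \<Longrightarrow> entry f x y = entry g x y) \<Longrightarrow> f = g"
  by (metis entry_eq_0 entry_inject ext)

lemma twist_comp: "twist c \<circ> twist d = twist (\<lambda>x y. c x y * d x y)"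
  by (rule ext, rule incidence_eqI) (simp add: twist.rep_eq mult.assoc)

lemma twist_one: "twist (\<lambda>x y. 1) = id"
  by (rule ext, rule incidence_eqI) (simp add: twist.rep_eq)

lemma twist_incidence_unit: "twist c (incidence_unit x y) = incidence_unit x y \<longleftrightarrow> c x y = 1"
  if "x \<le> y"
proof
  assume "twist c (incidence_unit x y) = incidence_unit x y"
  then have "entry (twist c (incidence_unit x y)) x y = entry (incidence_unit x y) x y" by simp
  with that show "c x y = 1" by (simp add: twist.rep_eq incidence_unit.rep_eq)
qed (auto intro!: incidence_eqI simp: twist.rep_eq incidence_unit.rep_eq)

context k_algebra
begin

lemma twist_in_Mult:
  fixes c :: "'x::{finite,order} \<Rightarrow> 'x \<Rightarrow> 'r"
  assumes c: "c \<in> cocycles"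
  shows "twist c \<in> Mult scale"
proof -
  let ?d = "\<lambda>x y. inv\<^bsub>central_units\<^esub> c x y"
  have "twist c (f * g) = twist c f * twist c g" for f g :: "('x, 'r) incidence"
  proof (rule incidence_eqI)
    fix x y :: 'x assume "x \<le> y"
    have "c x y * (entry f x z * entry g z y) = c x z * entry f x z * (c z y * entry g z y)"
      if "x \<le> z" "z \<le> y" for z
      using cocycle_mult[OF c that] central_units_commute[OF cocycle_closed[OF c, of z y]]
      by (metis mult.assoc)
    then show "entry (twist c (f * g)) x y = entry (twist c f * twist c g) x y"
      by (simp add: twist.rep_eq times_incidence.rep_eq sum_distrib_left)
  qed
  moreover have "twist c 1 = 1"
    by (rule incidence_eqI) (simp add: twist.rep_eq one_incidence.rep_eq cocycle_refl[OF c])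
  moreover have "bij (twist c)"
    by (rule o_bij[of "twist ?d"]) (simp_all add: twist_comp cocycle_closed[OF c] twist_one)
  moreover have "module (incidence_scale scale :: 'k \<Rightarrow> ('x, 'r) incidence \<Rightarrow> _)"
    using k_algebra_incidence by (rule k_algebra.axioms)
  then have "module_hom (incidence_scale scale) (incidence_scale scale) (twist c)"
    by (auto intro!: module_hom.intro incidence_eqI
        simp: module_hom_axioms_def twist.rep_eq plus_incidence.rep_eq entry_incidence_scale
          distrib_left scale_mult_right)
  ultimately have "algebra_automorphism (incidence_scale scale) (twist c)"
    by (simp add: algebra_automorphism_def)
  moreover have "twist c (a + m) = a + twist c m" if "a \<in> diagonal_part" for a m :: "('x, 'r) incidence"
  proof (rule incidence_eqI)
    fix x y
    show "entry (twist c (a + m)) x y = entry (a + twist c m) x y"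
      using that cocycle_refl[OF c]
      by (cases "x = y") (simp_all add: twist.rep_eq plus_incidence.rep_eq diagonal_part_def)
  qed
  moreover have "twist c \<in> strict_part \<rightarrow> strict_part"
    by (simp add: strict_part_def twist.rep_eq)
  ultimately show ?thesis unfolding Mult_def by blast
qed

text \<open>The cocycle is read off from the images of the units \<open>e\<^sub>x\<^sub>y\<close>. Compressing by
  diagonal idempotents reduces the entry of \<open>\<phi> f\<close> at \<open>(x, y)\<close> to that of \<open>\<phi> (r e\<^sub>x\<^sub>y)\<close> with
  \<open>r = f x y\<close>; here \<open>r e\<^sub>x\<^sub>y\<close> is both a left and a right multiple of \<open>e\<^sub>x\<^sub>y\<close> by an
  element that \<open>\<phi>\<close> fixes.\<close>

lemma MultE:
  fixes \<phi> :: "('x::{finite,order}, 'r) incidence \<Rightarrow> ('x, 'r) incidence"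
  assumes "\<phi> \<in> Mult scale"
  obtains c where "c \<in> cocycles" "\<phi> = twist c"
proof -
  from assms obtain \<beta> where
    hom: "module_hom (incidence_scale scale) (incidence_scale scale) \<phi>"
    and mult: "\<And>f g. \<phi> (f * g) = \<phi> f * \<phi> g" and "bij \<phi>"
    and \<beta>: "\<And>a m. a \<in> diagonal_part \<Longrightarrow> m \<in> strict_part \<Longrightarrow> \<phi> (a + m) = a + \<beta> m"
    unfolding Mult_def algebra_automorphism_def by blast
  have zero: "0 \<in> diagonal_part" "0 \<in> strict_part"
    by (simp_all add: diagonal_part_def strict_part_def zero_incidence.rep_eq)
  have "\<beta> 0 = 0" using \<beta>[OF zero] module_hom.zero[OF hom] by simp
  then have fix_diagonal: "\<phi> a = a" if "a \<in> diagonal_part" for a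
    using \<beta>[OF that zero(2)] by simp
  \<comment> \<open>\<open>D x r\<close> has the single entry \<open>r\<close> at \<open>(x, x)\<close>.\<close>
  define D :: "'x \<Rightarrow> 'r \<Rightarrow> ('x, 'r) incidence"
    where "D = (\<lambda>x r. Abs_incidence (\<lambda>u v. if u = x \<and> v = x then r else 0))"
  have D: "entry (D x r) u v = (if u = x \<and> v = x then r else 0)" for x r u v
    unfolding D_def by (subst Abs_incidence_inverse) auto
  have \<phi>D: "\<phi> (D x r) = D x r" for x r
    by (rule fix_diagonal) (simp add: diagonal_part_def D)
  have entry_unit: "entry (incidence_unit x y :: ('x, 'r) incidence) u v
      = (if u = x \<and> v = y then 1 else 0)" if "x \<le> y" for x y u v
    using that by (simp add: incidence_unit.rep_eq)
  have left: "entry (D x r * f) u y = (if u = x then r * entry f x y else 0)" for x r f u y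
    by (simp add: entry_times_UNIV D if_distrib[of "\<lambda>u. u * _"] cong: if_cong)
  have right: "entry (f * D y r) x u = (if u = y then entry f x y * r else 0)" for x r f u y
    by (simp add: entry_times_UNIV D if_distrib[of "(*) _"] cong: if_cong)
  have corner: "D x 1 * f * D y 1 = D x (entry f x y) * incidence_unit x y"
    and corner': "D x (entry f x y) * incidence_unit x y = incidence_unit x y * D y (entry f x y)"
    if "x \<le> y" for x y f
    using that by (auto intro!: incidence_eqI simp: left right entry_unit)
  define c where "c = (\<lambda>x y. if x \<le> y then entry (\<phi> (incidence_unit x y)) x y else 1)"
  have entry_right: "entry (\<phi> f) x y = entry f x y * c x y"
    and entry_left: "entry (\<phi> f) x y = c x y * entry f x y" if "x \<le> y" for f x y
  proof -
    have "entry (\<phi> f) x y = entry (\<phi> (D x 1 * f * D y 1)) x y"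
      by (simp add: mult \<phi>D right left)
    also note corner[OF that]
    finally have *: "entry (\<phi> f) x y = entry (\<phi> (D x (entry f x y) * incidence_unit x y)) x y" .
    from * show "entry (\<phi> f) x y = entry f x y * c x y"
      by (simp add: mult \<phi>D left c_def that)
    from * show "entry (\<phi> f) x y = c x y * entry f x y"
      by (simp add: corner'[OF that] mult \<phi>D right c_def that)
  qed
  have "c x y \<in> carrier central_units" for x y
  proof (cases "x \<le> y")
    case True
    obtain f where f: "\<phi> f = incidence_unit x y" using \<open>bij \<phi>\<close> by (metis bij_pointE)
    show ?thesis
    proof (rule central_unitsI)
      \<comment> \<open>Both products are the entry at \<open>(x, y)\<close> of the image of \<open>r e\<^sub>x\<^sub>y\<close>.\<close>
      show "c x y * r = r * c x y" for r
      proof -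
        have "entry (D x r * incidence_unit x y) x y = r"
          using True by (simp add: left incidence_unit.rep_eq)
        then show ?thesis using entry_left[OF True] entry_right[OF True] by metis
      qed
      show "c x y * entry f x y = 1"
        using entry_left[OF True, of f] True by (simp add: f incidence_unit.rep_eq)
    qed
  qed (simp add: c_def)
  moreover have "c x z = c x y * c y z" if "x \<le> y" "y \<le> z" for x y z
  proof -
    have "x \<le> z" using that by (rule order_trans)
    have "incidence_unit x z = incidence_unit x y * (incidence_unit y z :: ('x, 'r) incidence)"
      using that by (auto intro!: incidence_eqI simp: entry_times_UNIV incidence_unit.rep_eq
        if_distrib[of "\<lambda>u. u * _"] if_distrib[of "(*) _"] cong: if_cong)
    then have "c x z = entry (\<phi> (incidence_unit x y) * \<phi> (incidence_unit y z)) x z"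
      using \<open>x \<le> z\<close> by (simp add: c_def mult)
    also have "\<dots> = (\<Sum>u | x \<le> u \<and> u \<le> z. if u = y then c x y * c y z else 0)"
      unfolding times_incidence.rep_eq
      by (rule sum.cong) (auto simp: entry_left incidence_unit.rep_eq that)
    also have "\<dots> = c x y * c y z" using that by simp
    finally show ?thesis .
  qed
  ultimately have "c \<in> cocycles" by (rule cocyclesI)
  moreover have "\<phi> = twist c"
    by (rule ext, rule incidence_eqI) (simp add: twist.rep_eq entry_left)
  ultimately show thesis by (rule that)
qed

lemma Mult_eq_twist_cocycles:
  "(Mult scale :: (('x::{finite,order}, 'r) incidence \<Rightarrow> _) set) = twist ` cocycles"
  by (auto elim: MultE intro: twist_in_Mult)

lemma Mult1_eq_twist:
  "(Mult1 scale T :: (('x::{finite,order}, 'r) incidence \<Rightarrow> _) set)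
     = twist ` {c \<in> cocycles. \<forall>x y. {x, y} \<in> T \<and> x < y \<longrightarrow> c x y = 1}"
  unfolding Mult1_def Mult_eq_twist_cocycles by (force simp: twist_incidence_unit)

text \<open>Commuting with all diagonal elements means having central elements of \<open>R\<close> on the diagonal, so
  in the entry \<open>w x * a x y * v y\<close> of \<open>w * a * v\<close> the factor \<open>v y\<close> can be moved to the left of
  \<open>a x y\<close>, next to \<open>w x\<close>, the inverse of \<open>v x\<close>.\<close>

lemma Mult0_eq_twist_coboundaries:
  "(Mult0 scale :: (('x::{finite,order}, 'r) incidence \<Rightarrow> _) set) = twist ` coboundaries"
proof -
  have conj: "(\<lambda>a. w * a * v) = twist (\<lambda>x y. entry w x x * entry v y y)"
    if v: "v \<in> diagonal_part" and w: "w \<in> diagonal_part"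
      and central: "\<And>y r. entry v y y * r = r * entry v y y"
    for v w :: "('x, 'r) incidence"
  proof (rule ext, rule incidence_eqI)
    fix a :: "('x, 'r) incidence" and x y :: 'x
    have "entry (w * a) x z = entry w x x * entry a x z" for z
      unfolding entry_times_UNIV
      using w by (subst sum.remove[of _ x]) (auto simp: diagonal_part_def intro!: sum.neutral)
    then have "entry (w * a * v) x y = entry w x x * entry a x y * entry v y y"
      unfolding entry_times_UNIV[of "w * a"]
      using v by (subst sum.remove[of _ y]) (auto simp: diagonal_part_def intro!: sum.neutral)
    then show "entry (w * a * v) x y = entry (twist (\<lambda>x y. entry w x x * entry v y y) a) x y"
      by (simp add: twist.rep_eq mult.assoc central[of y "entry a x y"])
  qed
  have diag_mult: "entry (f * g) x x = entry f x x * entry g x x"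
    for f g :: "('x, 'r) incidence" and x
  proof -
    have "{z. x \<le> z \<and> z \<le> x} = {x}" by auto
    then show ?thesis by (simp add: times_incidence.rep_eq)
  qed
  define diag :: "('x \<Rightarrow> 'r) \<Rightarrow> ('x, 'r) incidence"
    where "diag = (\<lambda>u. Abs_incidence (\<lambda>x y. if x = y then u x else 0))"
  have diag: "entry (diag u) x y = (if x = y then u x else 0)" for u x y
    unfolding diag_def by (subst Abs_incidence_inverse) auto
  have diag_in: "diag u \<in> diagonal_part" for u by (simp add: diagonal_part_def diag)
  have diag_eqI: "f = g" if "f \<in> diagonal_part" "g \<in> diagonal_part"
    "\<And>x. entry f x x = entry g x x" for f g :: "('x, 'r) incidence"
    using that by (intro incidence_eqI) (metis (mono_tags, lifting) diagonal_part_def mem_Collect_eq)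
  have diag_times: "f * g \<in> diagonal_part" if "f \<in> diagonal_part" "g \<in> diagonal_part"
    for f g :: "('x, 'r) incidence"
    using that by (auto simp: diagonal_part_def entry_times_UNIV intro!: sum.neutral)
      (metis mult_zero_left mult_zero_right)
  have one_in: "1 \<in> diagonal_part" by (simp add: diagonal_part_def one_incidence.rep_eq)
  show ?thesis
  proof (intro equalityI subsetI)
    fix \<phi> :: "('x, 'r) incidence \<Rightarrow> ('x, 'r) incidence"
    assume "\<phi> \<in> Mult0 scale"
    then obtain v w where v: "v \<in> diagonal_part" and w: "w \<in> diagonal_part"
      and central: "\<And>u. u \<in> diagonal_part \<Longrightarrow> v * u = u * v"
      and vw: "v * w = 1" "w * v = 1" and \<phi>: "\<phi> = (\<lambda>a. w * a * v)"
      unfolding Mult0_def by blast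
    have comm: "entry v y y * r = r * entry v y y" for y r
      using arg_cong[OF central[OF diag_in[of "\<lambda>_. r"]], of "\<lambda>f. entry f y y"]
      by (simp add: diag_mult diag)
    have inv: "entry v y y * entry w y y = 1" for y
      using arg_cong[OF vw(1), of "\<lambda>f. entry f y y"] by (simp add: diag_mult one_incidence.rep_eq)
    have unit: "entry v y y \<in> carrier central_units" for y
      using comm inv by (rule central_unitsI)
    have "entry w y y = inv\<^bsub>central_units\<^esub> entry v y y" for y
      by (metis central_units_inv_mult(1) inv mult.assoc mult.left_neutral mult.right_neutral unit)
    with unit have "(\<lambda>x y. entry w x x * entry v y y) \<in> coboundaries"
      unfolding coboundaries_def by (intro CollectI exI[of _ "\<lambda>x. entry v x x"]) simp
    then show "\<phi> \<in> twist ` coboundaries" unfolding \<phi> conj[OF v w comm] by (rule imageI)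
  next
    fix \<phi> :: "('x, 'r) incidence \<Rightarrow> ('x, 'r) incidence"
    assume "\<phi> \<in> twist ` coboundaries"
    then obtain u where u: "\<And>x. u x \<in> carrier central_units"
      and \<phi>: "\<phi> = twist (\<lambda>x y. inv\<^bsub>central_units\<^esub> u x * u y)"
      and cob: "(\<lambda>x y. inv\<^bsub>central_units\<^esub> u x * u y) \<in> coboundaries"
      by (auto simp: coboundaries_def)
    let ?v = "diag u" and ?w = "diag (\<lambda>x. inv\<^bsub>central_units\<^esub> u x)"
    have "?v * f = f * ?v" if "f \<in> diagonal_part" for f
      using that u
      by (intro diag_eqI diag_times diag_in) (simp_all add: diag_mult diag central_units_commute[OF u])
    moreover have "?v * ?w = 1" "?w * ?v = 1"
      using u by (auto intro!: diag_eqI diag_times diag_in one_in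
          simp: diag_mult diag one_incidence.rep_eq)
    moreover have "\<phi> = (\<lambda>a. ?w * a * ?v)"
      using u by (subst conj) (simp_all add: diag_in diag \<phi> central_units_commute)
    moreover have "algebra_automorphism (incidence_scale scale) \<phi>"
      using twist_in_Mult[of "\<lambda>x y. inv\<^bsub>central_units\<^esub> u x * u y"] cob coboundaries_subset_cocycles
      unfolding \<phi> Mult_def by blast
    ultimately show "\<phi> \<in> Mult0 scale" unfolding Mult0_def using diag_in by blast
  qed
qed


section \<open>The direct product decomposition\<close>

lemma comm_group_Mult_group:
  "comm_group (Mult_group scale :: (('x::{finite,order}, 'r) incidence \<Rightarrow> _) monoid)"
proof (rule comm_groupI, goal_cases)
  case (1 \<phi> \<psi>)
  then show ?case
    by (auto simp: Mult_group_def Mult_eq_twist_cocycles twist_comp intro: cocycles_times)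
next
  case 2
  then show ?case
    using cocycles_one by (auto simp: Mult_group_def Mult_eq_twist_cocycles twist_one[symmetric])
next
  case (3 \<phi> \<psi> \<chi>)
  then show ?case by (simp add: Mult_group_def o_assoc)
next
  case (4 \<phi> \<psi>)
  then obtain c d where "c \<in> cocycles" "\<phi> = twist c" "\<psi> = twist d"
    by (auto simp: Mult_group_def Mult_eq_twist_cocycles)
  moreover from this have "c x y * d x y = d x y * c x y" for x y
    by (intro central_units_commute cocycle_closed)
  ultimately show ?case by (simp add: Mult_group_def twist_comp)
next
  case (5 \<phi>)
  then show ?case by (simp add: Mult_group_def)
next
  case (6 \<phi>)
  then obtain c where c: "c \<in> cocycles" "\<phi> = twist c"
    by (auto simp: Mult_group_def Mult_eq_twist_cocycles)
  with cocycles_inverse[OF c(1)] show ?case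
    by (intro bexI[of _ "twist (\<lambda>x y. inv\<^bsub>central_units\<^esub> c x y)"])
      (auto simp: Mult_group_def Mult_eq_twist_cocycles twist_comp twist_one cocycle_closed)
qed

lemma normal_twist_image:
  fixes C :: "('x::{finite,order} \<Rightarrow> 'x \<Rightarrow> 'r) set"
  assumes sub: "C \<subseteq> cocycles" and one: "(\<lambda>x y. 1) \<in> C"
    and times: "\<And>c d. c \<in> C \<Longrightarrow> d \<in> C \<Longrightarrow> (\<lambda>x y. c x y * d x y) \<in> C"
    and inverse: "\<And>c. c \<in> C \<Longrightarrow> (\<lambda>x y. inv\<^bsub>central_units\<^esub> c x y) \<in> C"
  shows "twist ` C \<lhd> Mult_group scale"
proof -
  interpret G: comm_group "Mult_group scale :: (('x, 'r) incidence \<Rightarrow> _) monoid"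
    by (rule comm_group_Mult_group)
  have twist_in: "twist c \<in> carrier (Mult_group scale)" if "c \<in> C" for c
    using that sub by (auto simp: Mult_group_def Mult_eq_twist_cocycles)
  have "subgroup (twist ` C) (Mult_group scale)"
  proof (rule G.subgroupI)
    show "twist ` C \<subseteq> carrier (Mult_group scale)" using twist_in by blast
    show "twist ` C \<noteq> {}" using one by blast
  next
    fix \<phi> assume "\<phi> \<in> twist ` C"
    then obtain c where c: "c \<in> C" "\<phi> = twist c" by blast
    have "inv\<^bsub>Mult_group scale\<^esub> \<phi> = twist (\<lambda>x y. inv\<^bsub>central_units\<^esub> c x y)"
      using c sub inverse[OF c(1)] twist_in
      by (intro G.inv_equality) (auto simp: Mult_group_def twist_comp twist_one subset_iff cocycle_closed)
    with inverse[OF c(1)] show "inv\<^bsub>Mult_group scale\<^esub> \<phi> \<in> twist ` C" by blast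
  next
    fix \<phi> \<psi> assume "\<phi> \<in> twist ` C" "\<psi> \<in> twist ` C"
    with times show "\<phi> \<otimes>\<^bsub>Mult_group scale\<^esub> \<psi> \<in> twist ` C"
      by (auto simp: Mult_group_def twist_comp)
  qed
  then show ?thesis by (rule G.subgroup_imp_normal)
qed

end

lemma comparability_graphD: "e \<in> comparability_graph \<Longrightarrow> \<exists>x y. x \<noteq> y \<and> e = {x, y}"
  by (auto simp: comparability_graph_def)

text \<open>The potential must be given a label for both directions of an edge, whereas the cocycle is
  meaningful only upwards; so it is extended downwards by inverses.\<close>

lemma cocycle_eq_coboundary_on_acyclic:
  fixes c :: "'x::{finite,order} \<Rightarrow> 'x \<Rightarrow> 'r::ring_1"
  assumes c: "c \<in> cocycles" and "T \<subseteq> comparability_graph" "\<nexists>p. graph_cycle T p"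
  shows "\<exists>d \<in> coboundaries. \<forall>x y. {x, y} \<in> T \<and> x < y \<longrightarrow> c x y = d x y"
proof -
  define g where "g = (\<lambda>x y. if x < y then c x y else if y < x then inv\<^bsub>central_units\<^esub> c y x else 1)"
  obtain v where v: "\<And>x. v x \<in> carrier central_units"
    and vg: "\<And>x y. {x, y} \<in> T \<Longrightarrow> v y = v x * g x y"
  proof -
    have closed: "g x y \<in> carrier central_units" for x y by (simp add: g_def cocycle_closed[OF c])
    have inverse: "g y x = inv\<^bsub>central_units\<^esub> g x y" if "x \<noteq> y" for x y
      using that by (auto simp: g_def cocycle_closed[OF c])
    have edges: "\<exists>x y. x \<noteq> y \<and> e = {x, y}" if "e \<in> T" for e
      using that assms(2) comparability_graphD by blast
    have "\<exists>v. (\<forall>x. v x \<in> carrier central_units) \<and>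
        (\<forall>x y. {x, y} \<in> T \<longrightarrow> v y = v x \<otimes>\<^bsub>central_units\<^esub> g x y)"
      by (rule central_units.potential_exists[OF finite assms(3) edges closed inverse])
    with that show thesis unfolding mult_central_units by blast
  qed
  have "c x y = inv\<^bsub>central_units\<^esub> v x * v y" if "{x, y} \<in> T" "x < y" for x y
    using vg[OF that(1)] that(2) v[of x] by (simp add: g_def flip: mult.assoc)
  with v show ?thesis
    by (intro bexI[of _ "\<lambda>x y. inv\<^bsub>central_units\<^esub> v x * v y"]) (auto simp: coboundaries_def)
qed

text \<open>A coboundary that is \<open>1\<close> on an edge comes from a potential with the same value at both ends,
  and equality of values spreads along paths.\<close>

lemma coboundary_trivial_on_connected:
  fixes d :: "'x::order \<Rightarrow> 'x \<Rightarrow> 'r::ring_1"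
  assumes d: "d \<in> coboundaries" and T: "T \<subseteq> comparability_graph" "graph_connected T"
    and trivial: "\<And>x y. {x, y} \<in> T \<Longrightarrow> x < y \<Longrightarrow> d x y = 1"
  shows "d = (\<lambda>x y. 1)"
proof -
  obtain v where v: "\<And>x. v x \<in> carrier central_units"
    and d: "d = (\<lambda>x y. inv\<^bsub>central_units\<^esub> v x * v y)"
    using d by (auto simp: coboundaries_def)
  have lt: "v x = v y" if "{x, y} \<in> T" "x < y" for x y
    using trivial[OF that] v unfolding d
    by (metis central_units_inv_mult(2) mult.assoc mult.left_neutral mult.right_neutral)
  have edge: "v x = v y" if "{x, y} \<in> T" for x y
  proof -
    have "x < y \<or> y < x"
      using that T(1) by (auto simp: comparability_graph_def doubleton_eq_iff order.strict_iff_order)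
    with that lt[of x y] lt[of y x] show ?thesis by (auto simp: insert_commute)
  qed
  have "v x = v y" for x y
  proof -
    have "(x, y) \<in> {(x, y). {x, y} \<in> T}\<^sup>*" using T(2) by (simp add: graph_connected_def)
    then show ?thesis by induction (auto dest: edge)
  qed
  with v have "inv\<^bsub>central_units\<^esub> v x * v y = 1" for x y
    by (metis central_units_inv_mult(1))
  then show ?thesis unfolding d by simp
qed

theorem theorem3p6:
  fixes scale :: "'k::comm_ring_1 \<Rightarrow> 'r::ring_1 \<Rightarrow> 'r"
    and T :: "'x::{finite,order} set set"
  assumes "k_algebra scale"
    and "graph_connected (comparability_graph :: 'x set set)"
    and "spanning_tree T comparability_graph"
  shows "internal_direct_product (Mult_group scale) (Mult1 scale T) (Mult0 scale)"
proof -
  interpret k_algebra scale by fact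
  let ?C1 = "{c \<in> cocycles. \<forall>x y. {x, y} \<in> T \<and> x < y \<longrightarrow> c x y = 1} :: ('x \<Rightarrow> 'x \<Rightarrow> 'r) set"
  let ?G = "Mult_group scale :: (('x, 'r) incidence \<Rightarrow> _) monoid"
  have T: "T \<subseteq> comparability_graph" "graph_connected T" "\<nexists>p. graph_cycle T p"
    using assms(3) by (auto simp: spanning_tree_def)
  have "twist ` ?C1 \<lhd> ?G"
  proof (rule normal_twist_image)
    show "(\<lambda>x y. inv\<^bsub>central_units\<^esub> c x y) \<in> ?C1" if "c \<in> ?C1" for c
      using that cocycles_inverse[of c] by auto
  qed (auto intro: cocycles_one cocycles_times)
  moreover have "twist ` coboundaries \<lhd> ?G"
    by (intro normal_twist_image coboundaries_subset_cocycles coboundaries_one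
        coboundaries_times coboundaries_inverse)
  moreover have "twist ` ?C1 <#>\<^bsub>?G\<^esub> twist ` coboundaries = carrier ?G"
  proof (intro equalityI subsetI)
    fix \<phi> assume "\<phi> \<in> twist ` ?C1 <#>\<^bsub>?G\<^esub> twist ` coboundaries"
    then obtain c d where "c \<in> cocycles" "d \<in> coboundaries" "\<phi> = twist c \<circ> twist d"
      by (auto simp: set_mult_def Mult_group_def)
    with cocycles_times[of c d] coboundaries_subset_cocycles show "\<phi> \<in> carrier ?G"
      by (auto simp: Mult_group_def Mult_eq_twist_cocycles twist_comp)
  next
    fix \<phi> assume "\<phi> \<in> carrier ?G"
    then obtain c where c: "c \<in> cocycles" "\<phi> = twist c"
      by (auto simp: Mult_group_def Mult_eq_twist_cocycles)
    obtain d where d: "d \<in> coboundaries" "\<And>x y. {x, y} \<in> T \<Longrightarrow> x < y \<Longrightarrow> c x y = d x y"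
      using cocycle_eq_coboundary_on_acyclic[OF c(1) T(1,3)] by blast
    have dc: "d \<in> cocycles" using d(1) coboundaries_subset_cocycles by blast
    let ?b = "\<lambda>x y. c x y * inv\<^bsub>central_units\<^esub> d x y"
    have "?b \<in> ?C1"
      using cocycles_times[OF c(1) cocycles_inverse[OF dc]] d(2) cocycle_closed[OF dc] by fastforce
    moreover have "twist ?b \<circ> twist d = \<phi>"
      by (simp add: twist_comp c(2) mult.assoc cocycle_closed[OF dc])
    ultimately show "\<phi> \<in> twist ` ?C1 <#>\<^bsub>?G\<^esub> twist ` coboundaries"
      using d(1) unfolding set_mult_def Mult_group_def by auto
  qed
  moreover have "twist ` ?C1 \<inter> twist ` coboundaries = {\<one>\<^bsub>?G\<^esub>}"
  proof (intro equalityI subsetI)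
    fix \<phi> :: "('x, 'r) incidence \<Rightarrow> ('x, 'r) incidence"
    assume \<phi>: "\<phi> \<in> twist ` ?C1 \<inter> twist ` coboundaries"
    then obtain d where d: "d \<in> coboundaries" "\<phi> = twist d" by blast
    have "d x y = 1" if "{x, y} \<in> T" "x < y" for x y
      using \<phi> that twist_incidence_unit[of x y d] twist_incidence_unit[of x y]
      unfolding d(2) by force
    with d(1) T(1,2) have "d = (\<lambda>x y. 1)" by (intro coboundary_trivial_on_connected)
    then show "\<phi> \<in> {\<one>\<^bsub>?G\<^esub>}" by (simp add: d(2) twist_one Mult_group_def)
  next
    fix \<phi> assume "\<phi> \<in> {\<one>\<^bsub>?G\<^esub>}"
    then have "\<phi> = twist (\<lambda>x y. 1)" by (simp add: twist_one Mult_group_def)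
    with cocycles_one coboundaries_one show "\<phi> \<in> twist ` ?C1 \<inter> twist ` coboundaries" by auto
  qed
  ultimately show ?thesis
    unfolding internal_direct_product_def Mult1_eq_twist Mult0_eq_twist_coboundaries by blast
qed

end
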